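(* Let $N_H\in\mathbb{N}$ with $N_H\ge3$ and $\Delta t>0$. Let $(\mathbf{C}^m,E^m,\Phi^m)_{m\ge0}$, with $\mathbf{C}^m=(C_0^m,\dots,C_{N_H-1}^m)$ and all components in $V_h^k$, be a solution of the following first order scheme: for every $m\ge0$, $(E^m,\Phi^m)$ solves the discrete Poisson problem with density coefficient $C_0^m$; for every $n\in\{0,\dots,N_H-1\}\setminus\{2\}$ and every $\phi_n\in V_h^k$, $$\frac{(C_n^{m+1}-C_n^m,\phi_n)}{\Delta t}+a_n(g_n^m,\phi_n)+b_n(\mathbf{C}^m,E^m,\Phi^m,\phi_n)=0;$$ and for every $\phi_2\in V_h^k$, $$\frac{(C_2^{m+1}-C_2^m,\phi_2)}{\Delta t}+a_2(g_2^m,\phi_2)+b_2(\mathbf{C}^m,E^{m+\frac12},\Phi^{m+\frac12},\phi_2)=0,$$ where $E^{m+\frac12}=\frac12(E^m+E^{m+1})$ and $\Phi^{m+\frac12}=\frac12(\Phi^m+\Phi^{m+1})$. Then discrete mass and momentum are conserved: for all $m\ge0$, $$v_{th}^{\ell+1}\int_0^L C_\ell^m\,dx=v_{th}^{\ell+1}\int_0^L C_\ell^0\,dx,\qquad \ell=0,1,$$ and the discrete total energy $$\mathcal{E}_h^m:=\frac12\int_0^L\left[v_{th}^3\left(\sqrt2\,C_2^m+C_0^m\right)+|E^m|^2\right]dx+\frac12\,\beta\sum_j[\Phi^m]^2_{j-\frac12}$$ is independent of $m\ge0$.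
   Context: Fix $L>0$, $v_{th}>0$, $\rho_0\in\mathbb{R}$, $\beta>0$ (a constant, possibly depending on the mesh size $h$, e.g. a constant times $1/h$), and an integer $k\ge0$. The interval $\Omega=[0,L]$ is partitioned by $0=x_{\frac12}<x_{\frac32}<\dots<x_{N_x+\frac12}=L$ into cells $I_j=[x_{j-\frac12},x_{j+\frac12}]$, $j=1,\dots,N_x$; periodic boundary conditions identify $x_{\frac12}$ and $x_{N_x+\frac12}$ (so at the interface $x_{\frac12}\equiv x_{N_x+\frac12}$ the left trace is taken from $I_{N_x}$ and the right trace from $I_1$). Set $V_h^k=\{u\in L^2(\Omega): u|_{I_j}\text{ is a polynomial of degree at most }k,\ \forall j\}$. For $u\in V_h^k$, $u^\pm_{j+\frac12}$ are the right ($+$) and left ($-$) limits at $x_{j+\frac12}$, $[u]_{j+\frac12}=u^+_{j+\frac12}-u^-_{j+\frac12}$ and $\{u\}_{j+\frac12}=\frac12(u^+_{j+\frac12}+u^-_{j+\frac12})$. Sums over $j$ run over $j=1,\dots,N_x$. $(\cdot,\cdot)$ is the $L^2(0,L)$ inner product and $(\cdot,\cdot)_{I_j}$ the $L^2(I_j)$ inner product. Discrete Poisson problem with density coefficient $C_0\in V_h^k$: $(E,\Phi)\in V_h^k\times V_h^k$ satisfies, for all cells $I_j$ and all $\eta,\zeta\in V_h^k$, $$\int_{I_j}\Phi\,\eta'\,dx-\hat\Phi_{j+\frac12}\eta^-_{j+\frac12}+\hat\Phi_{j-\frac12}\eta^+_{j-\frac12}=\int_{I_j}E\,\eta\,dx,$$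 $$-\int_{I_j}E\,\zeta'\,dx+\hat E_{j+\frac12}\zeta^-_{j+\frac12}-\hat E_{j-\frac12}\zeta^+_{j-\frac12}=\int_{I_j}(v_{th}C_0-\rho_0)\,\zeta\,dx,$$ with $\hat\Phi=\{\Phi\}$, $\hat E=\{E\}-\beta[\Phi]$ at every interface. Transport terms: for $\mathbf{C}=(C_0,\dots,C_{N_H-1})$, with conventions $C_{-1}=0$, $C_{N_H}=0$, let $g_n=v_{th}(\sqrt{n+1}\,C_{n+1}+\sqrt n\,C_{n-1})$, $\hat g_n=\frac12[g_n^-+g_n^+-\alpha(C_n^+-C_n^-)]$ with $\alpha=v_{th}\sqrt{N_H}$ (global Lax–Friedrichs flux), $$a_n^j(g_n,\phi)=-\int_{I_j}g_n\,\phi'\,dx+\hat g_{n,j+\frac12}\phi^-_{j+\frac12}-\hat g_{n,j-\frac12}\phi^+_{j-\frac12},\qquad a_n=\sum_j a_n^j,$$ and $\hat C_1=\hat g_0/v_{th}$. $g_n^m$ denotes $g_n$ (with its flux) computed from $\mathbf{C}^m$. Source terms: $b_n=\sum_j b_n^j$, where $b_0^j=0$, $b_1^j(\mathbf{C},E,\Phi,\phi)=-\frac1{v_{th}}(E\,C_0,\phi)_{I_j}-\langle r_1^j,\phi\rangle$, $b_2^j(\mathbf{C},E,\Phi,\phi)=-\frac{\sqrt2}{v_{th}}(E\,C_1,\phi)_{I_j}-\langle r_2^j,\phi\rangle$, $b_n^j(\mathbf{C},E,\Phi,\phi)=-\frac{\sqrt n}{v_{th}}(E\,C_{n-1},\phi)_{I_j}$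 for $3\le n\le N_H-1$, with $$\langle r_1^j,\phi\rangle=-\frac{\beta}{2v_{th}^2}\left([\Phi]_{j-\frac12}[E]_{j-\frac12}\phi^+_{j-\frac12}+[\Phi]_{j+\frac12}[E]_{j+\frac12}\phi^-_{j+\frac12}\right),$$ $$\langle r_2^j,\phi\rangle=\frac1{\sqrt2\,v_{th}}\left((\{C_1\}-\hat C_1)_{j-\frac12}[\Phi]_{j-\frac12}\phi^+_{j-\frac12}+(\{C_1\}-\hat C_1)_{j+\frac12}[\Phi]_{j+\frac12}\phi^-_{j+\frac12}\right),$$ where $C_1,\hat C_1$ are computed from the argument $\mathbf{C}$ and $E,\Phi$ are the corresponding arguments of $b_n$. *)

theory Defs
  imports "HOL-Analysis.Analysis"
begin

text \<open>
  The interface \<open>x\<^bsub>i+1/2\<^esub>\<close> is \<open>X i\<close>, for \<open>i = 0, \<dots>, N\<close>. Thus the cell \<open>I\<^sub>j\<close>, for \<open>j = 1, \<dots>, N\<close>,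
  is \<open>{X (j - 1)..X j}\<close>, and the interface indices \<open>j - 1/2\<close> and \<open>j + 1/2\<close> of the usual notation
  become \<open>j - 1\<close> and \<open>j\<close>.
\<close>

definition mesh :: "(nat \<Rightarrow> real) \<Rightarrow> nat \<Rightarrow> real \<Rightarrow> bool" where
  "mesh X N L \<longleftrightarrow> 0 < N \<and> X 0 = 0 \<and> X N = L \<and> (\<forall>i<N. X i < X (Suc i))"

text \<open>
  An element of \<open>V\<^sub>h\<^sup>k\<close> is given by a representative \<open>real \<Rightarrow> real\<close> of its class in \<open>L\<^sup>2(0,L)\<close>: the
  values at the interfaces and outside \<open>[0,L]\<close> are unconstrained. None of the notions below depends
  on them: these use only integrals over subintervals of \<open>[0,L]\<close>, one-sided limits from within
  \<open>[0,L]\<close>, and derivatives at interior points of cells, up to null sets.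
\<close>

definition dg_space :: "(nat \<Rightarrow> real) \<Rightarrow> nat \<Rightarrow> nat \<Rightarrow> (real \<Rightarrow> real) set" where
  "dg_space X N k =
     {u. \<forall>j\<in>{1..N}. \<exists>p. degree p \<le> k \<and> (\<forall>x\<in>{X (j - 1)<..<X j}. u x = poly p x)}"

text \<open>
  Traces at the interface \<open>i\<close>. The interfaces \<open>0\<close> and \<open>N\<close> are identified: both take the right trace
  from the first cell and the left trace from the last one.
\<close>

definition trace_right :: "(nat \<Rightarrow> real) \<Rightarrow> nat \<Rightarrow> (real \<Rightarrow> real) \<Rightarrow> nat \<Rightarrow> real" where
  "trace_right X N u i = Lim (at_right (if i = N then X 0 else X i)) u"

definition trace_left :: "(nat \<Rightarrow> real) \<Rightarrow> nat \<Rightarrow> (real \<Rightarrow> real) \<Rightarrow> nat \<Rightarrow> real" where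
  "trace_left X N u i = Lim (at_left (if i = 0 then X N else X i)) u"

definition jump :: "(nat \<Rightarrow> real) \<Rightarrow> nat \<Rightarrow> (real \<Rightarrow> real) \<Rightarrow> nat \<Rightarrow> real" where
  "jump X N u i = trace_right X N u i - trace_left X N u i"

definition avg :: "(nat \<Rightarrow> real) \<Rightarrow> nat \<Rightarrow> (real \<Rightarrow> real) \<Rightarrow> nat \<Rightarrow> real" where
  "avg X N u i = (trace_right X N u i + trace_left X N u i) / 2"

definition flux_E ::
  "(nat \<Rightarrow> real) \<Rightarrow> nat \<Rightarrow> real \<Rightarrow> (real \<Rightarrow> real) \<Rightarrow> (real \<Rightarrow> real) \<Rightarrow> nat \<Rightarrow> real" where
  "flux_E X N \<beta> E \<Phi> i = avg X N E i - \<beta> * jump X N \<Phi> i"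

definition flux_Phi :: "(nat \<Rightarrow> real) \<Rightarrow> nat \<Rightarrow> (real \<Rightarrow> real) \<Rightarrow> nat \<Rightarrow> real" where
  "flux_Phi X N \<Phi> i = avg X N \<Phi> i"

definition discrete_poisson ::
  "(nat \<Rightarrow> real) \<Rightarrow> nat \<Rightarrow> nat \<Rightarrow> real \<Rightarrow> real \<Rightarrow> real \<Rightarrow>
   (real \<Rightarrow> real) \<Rightarrow> (real \<Rightarrow> real) \<Rightarrow> (real \<Rightarrow> real) \<Rightarrow> bool" where
  "discrete_poisson X N k vth \<rho>\<^sub>0 \<beta> C\<^sub>0 E \<Phi> \<longleftrightarrow>
     E \<in> dg_space X N k \<and> \<Phi> \<in> dg_space X N k \<and>
     (\<forall>j\<in>{1..N}. \<forall>\<eta>\<in>dg_space X N k. \<forall>\<zeta>\<in>dg_space X N k.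
        integral {X (j - 1)..X j} (\<lambda>x. \<Phi> x * deriv \<eta> x)
          - flux_Phi X N \<Phi> j * trace_left X N \<eta> j
          + flux_Phi X N \<Phi> (j - 1) * trace_right X N \<eta> (j - 1)
          = integral {X (j - 1)..X j} (\<lambda>x. E x * \<eta> x) \<and>
        - integral {X (j - 1)..X j} (\<lambda>x. E x * deriv \<zeta> x)
          + flux_E X N \<beta> E \<Phi> j * trace_left X N \<zeta> j
          - flux_E X N \<beta> E \<Phi> (j - 1) * trace_right X N \<zeta> (j - 1)
          = integral {X (j - 1)..X j} (\<lambda>x. (vth * C\<^sub>0 x - \<rho>\<^sub>0) * \<zeta> x))"

text \<open>
  A coefficient family \<open>C\<close> is indexed by all of \<open>nat\<close>, but only \<open>C 0, \<dots>, C (NH - 1)\<close> are meaningful;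
  the conditionals implement \<open>C\<^bsub>-1\<^esub> = 0\<close> and \<open>C\<^bsub>NH\<^esub> = 0\<close>.
\<close>

definition transport ::
  "real \<Rightarrow> nat \<Rightarrow> (nat \<Rightarrow> real \<Rightarrow> real) \<Rightarrow> nat \<Rightarrow> real \<Rightarrow> real" where
  "transport vth NH C n x =
     vth * (sqrt (real n + 1) * (if n + 1 < NH then C (n + 1) x else 0)
            + sqrt (real n) * (if n = 0 then 0 else C (n - 1) x))"

definition flux_g ::
  "(nat \<Rightarrow> real) \<Rightarrow> nat \<Rightarrow> real \<Rightarrow> nat \<Rightarrow> (nat \<Rightarrow> real \<Rightarrow> real) \<Rightarrow> nat \<Rightarrow> nat \<Rightarrow> real" where
  "flux_g X N vth NH C n i =
     (trace_left X N (transport vth NH C n) i + trace_right X N (transport vth NH C n) i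
      - vth * sqrt (real NH) * (trace_right X N (C n) i - trace_left X N (C n) i)) / 2"

definition a_form ::
  "(nat \<Rightarrow> real) \<Rightarrow> nat \<Rightarrow> real \<Rightarrow> nat \<Rightarrow> (nat \<Rightarrow> real \<Rightarrow> real) \<Rightarrow> nat \<Rightarrow> (real \<Rightarrow> real) \<Rightarrow> real" where
  "a_form X N vth NH C n \<phi> =
     (\<Sum>j=1..N. - integral {X (j - 1)..X j} (\<lambda>x. transport vth NH C n x * deriv \<phi> x)
                + flux_g X N vth NH C n j * trace_left X N \<phi> j
                - flux_g X N vth NH C n (j - 1) * trace_right X N \<phi> (j - 1))"

definition flux_C1 ::
  "(nat \<Rightarrow> real) \<Rightarrow> nat \<Rightarrow> real \<Rightarrow> nat \<Rightarrow> (nat \<Rightarrow> real \<Rightarrow> real) \<Rightarrow> nat \<Rightarrow> real" where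
  "flux_C1 X N vth NH C i = flux_g X N vth NH C 0 i / vth"

definition r1_term ::
  "(nat \<Rightarrow> real) \<Rightarrow> nat \<Rightarrow> real \<Rightarrow> real \<Rightarrow>
   (real \<Rightarrow> real) \<Rightarrow> (real \<Rightarrow> real) \<Rightarrow> nat \<Rightarrow> (real \<Rightarrow> real) \<Rightarrow> real" where
  "r1_term X N vth \<beta> E \<Phi> j \<phi> =
     - \<beta> / (2 * vth ^ 2) *
       (jump X N \<Phi> (j - 1) * jump X N E (j - 1) * trace_right X N \<phi> (j - 1)
        + jump X N \<Phi> j * jump X N E j * trace_left X N \<phi> j)"

definition r2_term ::
  "(nat \<Rightarrow> real) \<Rightarrow> nat \<Rightarrow> real \<Rightarrow> nat \<Rightarrow>
   (nat \<Rightarrow> real \<Rightarrow> real) \<Rightarrow> (real \<Rightarrow> real) \<Rightarrow> nat \<Rightarrow> (real \<Rightarrow> real) \<Rightarrow> real" where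
  "r2_term X N vth NH C \<Phi> j \<phi> =
     1 / (sqrt 2 * vth) *
       ((avg X N (C 1) (j - 1) - flux_C1 X N vth NH C (j - 1))
           * jump X N \<Phi> (j - 1) * trace_right X N \<phi> (j - 1)
        + (avg X N (C 1) j - flux_C1 X N vth NH C j)
           * jump X N \<Phi> j * trace_left X N \<phi> j)"

definition b_cell ::
  "(nat \<Rightarrow> real) \<Rightarrow> nat \<Rightarrow> real \<Rightarrow> nat \<Rightarrow> real \<Rightarrow> nat \<Rightarrow> nat \<Rightarrow>
   (nat \<Rightarrow> real \<Rightarrow> real) \<Rightarrow> (real \<Rightarrow> real) \<Rightarrow> (real \<Rightarrow> real) \<Rightarrow> (real \<Rightarrow> real) \<Rightarrow> real" where
  "b_cell X N vth NH \<beta> n j C E \<Phi> \<phi> =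
     (if n = 0 then 0
      else - sqrt (real n) / vth * integral {X (j - 1)..X j} (\<lambda>x. E x * C (n - 1) x * \<phi> x)
           - (if n = 1 then r1_term X N vth \<beta> E \<Phi> j \<phi>
              else if n = 2 then r2_term X N vth NH C \<Phi> j \<phi>
              else 0))"

definition b_form ::
  "(nat \<Rightarrow> real) \<Rightarrow> nat \<Rightarrow> real \<Rightarrow> nat \<Rightarrow> real \<Rightarrow> nat \<Rightarrow>
   (nat \<Rightarrow> real \<Rightarrow> real) \<Rightarrow> (real \<Rightarrow> real) \<Rightarrow> (real \<Rightarrow> real) \<Rightarrow> (real \<Rightarrow> real) \<Rightarrow> real" where
  "b_form X N vth NH \<beta> n C E \<Phi> \<phi> = (\<Sum>j=1..N. b_cell X N vth NH \<beta> n j C E \<Phi> \<phi>)"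

definition total_energy ::
  "(nat \<Rightarrow> real) \<Rightarrow> nat \<Rightarrow> real \<Rightarrow> real \<Rightarrow> real \<Rightarrow>
   (nat \<Rightarrow> real \<Rightarrow> real) \<Rightarrow> (real \<Rightarrow> real) \<Rightarrow> (real \<Rightarrow> real) \<Rightarrow> real" where
  "total_energy X N L vth \<beta> C E \<Phi> =
     1 / 2 * integral {0..L} (\<lambda>x. vth ^ 3 * (sqrt 2 * C 2 x + C 0 x) + \<bar>E x\<bar> ^ 2)
     + 1 / 2 * \<beta> * (\<Sum>j=1..N. (jump X N \<Phi> (j - 1)) ^ 2)"

end

theory Submission
  imports Defs
begin

text \<open>
  Testing with the constant \<open>1\<close> makes all transport terms telescope over the periodic mesh, so only
  sources matter. For the momentum, the Poisson equations tested with \<open>\<zeta> = E\<close> and \<open>\<eta> = 1\<close> give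
  \<open>v\<^sub>t\<^sub>h (E, C\<^sub>0) = \<beta> \<Sum> [\<Phi>] [E]\<close>, which the correction \<open>r\<^sub>1\<close> removes. For the energy, let \<open>\<delta>\<close>
  be the difference of two consecutive time levels. By linearity, testing with
  \<open>\<eta> = \<delta>E\<close> and \<open>\<zeta>\<close> the mean potential shows that the electric energy changes by \<open>v\<^sub>t\<^sub>h\<close> times the
  pairing of \<open>\<delta>C\<^sub>0\<close> with the mean potential. The \<open>C\<^sub>0\<close> equation expresses this pairing through
  \<open>C\<^sub>1\<close> and its numerical flux, and the Poisson equation tested with \<open>\<eta> = C\<^sub>1\<close> shows that the source
  of the \<open>C\<^sub>2\<close> equation, including \<open>r\<^sub>2\<close>, changes the kinetic energy by the opposite amount.
\<close>

section \<open>Polynomial pieces on a single cell\<close>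

lemma deriv_eq_pderiv:
  fixes u :: "real \<Rightarrow> real"
  assumes "\<And>x. x \<in> {a<..<b} \<Longrightarrow> u x = poly p x" "x \<in> {a<..<b}"
  shows "(u has_field_derivative poly (pderiv p) x) (at x)" "deriv u x = poly (pderiv p) x"
proof -
  show "(u has_field_derivative poly (pderiv p) x) (at x)"
    using poly_DERIV[of p x]
    by (rule has_field_derivative_transform_within_open[where S = "{a<..<b}"])
      (use assms in auto)
  then show "deriv u x = poly (pderiv p) x" by (rule DERIV_imp_deriv)
qed

lemma tendsto_at_right_cell:
  fixes u :: "real \<Rightarrow> real"
  assumes "\<And>x. x \<in> {a<..<b} \<Longrightarrow> u x = poly p x" "a < b"
  shows "(u \<longlongrightarrow> poly p a) (at_right a)"
proof -
  have "(poly p \<longlongrightarrow> poly p a) (at_right a)" by (rule tendsto_poly[OF tendsto_ident_at])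
  moreover have "\<forall>\<^sub>F x in at_right a. poly p x = u x"
    using assms by (auto simp: eventually_at_right intro!: exI[of _ b])
  ultimately show ?thesis by (rule Lim_transform_eventually)
qed

lemma tendsto_at_left_cell:
  fixes u :: "real \<Rightarrow> real"
  assumes "\<And>x. x \<in> {a<..<b} \<Longrightarrow> u x = poly p x" "a < b"
  shows "(u \<longlongrightarrow> poly p b) (at_left b)"
proof -
  have "(poly p \<longlongrightarrow> poly p b) (at_left b)" by (rule tendsto_poly[OF tendsto_ident_at])
  moreover have "\<forall>\<^sub>F x in at_left b. poly p x = u x"
    using assms by (auto simp: eventually_at_left intro!: exI[of _ a])
  ultimately show ?thesis by (rule Lim_transform_eventually)
qed

lemma integral_real_lincomb:
  fixes u v :: "real \<Rightarrow> real"
  assumes "u integrable_on S" "v integrable_on S"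
  shows "integral S (\<lambda>x. a * u x + b * v x) = a * integral S u + b * integral S v"
  by (intro integral_unique has_integral_add has_integral_mult_right integrable_integral assms)

section \<open>The mesh and closure properties of the piecewise polynomial spaces\<close>

locale dg_mesh =
  fixes X :: "nat \<Rightarrow> real" and N :: nat and L :: real
  assumes is_mesh: "mesh X N L"
begin

text \<open>Keeps cell indices in the form \<open>j - 1\<close> instead of \<open>j - Suc 0\<close>,
  so that the lemmas below still match after simplification.\<close>

declare One_nat_def [simp del]

lemma N_pos: "0 < N" and X_0: "X 0 = 0" and X_N: "X N = L"
  and X_Suc: "i < N \<Longrightarrow> X i < X (Suc i)"
  using is_mesh by (auto simp: mesh_def)

lemma X_cell: "j \<in> {1..N} \<Longrightarrow> X (j - 1) < X j"
  using X_Suc[of "j - 1"] by auto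

lemma dg_space_cellE:
  assumes "u \<in> dg_space X N k" "j \<in> {1..N}"
  obtains p where "degree p \<le> k" "\<And>x. x \<in> {X (j - 1)<..<X j} \<Longrightarrow> u x = poly p x"
proof -
  from assms have "\<exists>p. degree p \<le> k \<and> (\<forall>x\<in>{X (j - 1)<..<X j}. u x = poly p x)"
    unfolding dg_space_def by blast
  then show thesis using that by blast
qed

lemma dg_space_const: "(\<lambda>x. c) \<in> dg_space X N k"
  unfolding dg_space_def by (auto intro!: exI[of _ "[:c:]"])

lemma dg_space_lincomb:
  assumes "u \<in> dg_space X N k" "v \<in> dg_space X N k"
  shows "(\<lambda>x. a * u x + b * v x) \<in> dg_space X N k"
  unfolding dg_space_def
proof (intro CollectI ballI)
  fix j assume j: "j \<in> {1..N}"
  obtain p q where "degree p \<le> k" "\<And>x. x \<in> {X (j - 1)<..<X j} \<Longrightarrow> u x = poly p x"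
    and "degree q \<le> k" "\<And>x. x \<in> {X (j - 1)<..<X j} \<Longrightarrow> v x = poly q x"
    using dg_space_cellE[OF assms(1) j] dg_space_cellE[OF assms(2) j] by metis
  then show "\<exists>p. degree p \<le> k \<and> (\<forall>x\<in>{X (j - 1)<..<X j}. a * u x + b * v x = poly p x)"
    by (intro exI[of _ "smult a p + smult b q"])
      (auto intro!: degree_add_le order_trans[OF degree_smult_le])
qed

text \<open>Products such as \<open>E x * D x\<close> leave the space of degree \<open>k\<close>.
  Since traces and integrals are treated for every degree, membership in a larger space is enough,
  which is why many lemmas below carry two degrees.\<close>

lemma dg_space_mult:
  assumes "u \<in> dg_space X N k" "v \<in> dg_space X N l"
  shows "(\<lambda>x. u x * v x) \<in> dg_space X N (k + l)"
  unfolding dg_space_def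
proof (intro CollectI ballI)
  fix j assume j: "j \<in> {1..N}"
  obtain p q where "degree p \<le> k" "\<And>x. x \<in> {X (j - 1)<..<X j} \<Longrightarrow> u x = poly p x"
    and "degree q \<le> l" "\<And>x. x \<in> {X (j - 1)<..<X j} \<Longrightarrow> v x = poly q x"
    using dg_space_cellE[OF assms(1) j] dg_space_cellE[OF assms(2) j] by metis
  then show "\<exists>p. degree p \<le> k + l \<and> (\<forall>x\<in>{X (j - 1)<..<X j}. u x * v x = poly p x)"
    by (intro exI[of _ "p * q"]) (auto intro!: order_trans[OF degree_mult_le] add_mono)
qed

text \<open>Keeping the bound \<open>k\<close> allows \<open>u\<close> and \<open>deriv u\<close> to
  enter the same lemmas. The unknown values of \<open>deriv u\<close> at the interfaces do no harm,
  as \<open>dg_space\<close> constrains only open cells.\<close>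

lemma dg_space_deriv:
  assumes "u \<in> dg_space X N k"
  shows "deriv u \<in> dg_space X N k"
  unfolding dg_space_def
proof (intro CollectI ballI)
  fix j assume j: "j \<in> {1..N}"
  obtain p where p: "degree p \<le> k" "\<And>x. x \<in> {X (j - 1)<..<X j} \<Longrightarrow> u x = poly p x"
    using dg_space_cellE[OF assms j] by metis
  show "\<exists>p. degree p \<le> k \<and> (\<forall>x\<in>{X (j - 1)<..<X j}. deriv u x = poly p x)"
    using p(1) deriv_eq_pderiv(2)[OF p(2)]
    by (intro exI[of _ "pderiv p"]) (auto simp: degree_pderiv)
qed

section \<open>Traces, jumps and averages at the interfaces\<close>

lemma trace_right_eqI:
  "(u \<longlongrightarrow> c) (at_right (if i = N then X 0 else X i)) \<Longrightarrow> trace_right X N u i = c"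
  unfolding trace_right_def by (rule tendsto_Lim) auto

lemma trace_left_eqI:
  "(u \<longlongrightarrow> c) (at_left (if i = 0 then X N else X i)) \<Longrightarrow> trace_left X N u i = c"
  unfolding trace_left_def by (rule tendsto_Lim) auto

text \<open>\<open>Lim\<close> is a choice operator; a polynomial on the adjacent cell guarantees
  that the limit exists, so the trace is a genuine one-sided limit.\<close>

lemma tendsto_trace_right:
  assumes "u \<in> dg_space X N k" "i \<le> N"
  shows "(u \<longlongrightarrow> trace_right X N u i) (at_right (if i = N then X 0 else X i))"
proof -
  \<comment> \<open>The cell to the right of interface \<open>i\<close> has index
    \<open>Suc r\<close>; at \<open>i = N\<close> this is the first cell.\<close>
  define r where "r = (if i = N then 0 else i)"
  have r: "Suc r \<in> {1..N}" using assms(2) N_pos by (auto simp: r_def)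
  obtain p where "\<And>x. x \<in> {X r<..<X (Suc r)} \<Longrightarrow> u x = poly p x"
    using dg_space_cellE[OF assms(1) r] by auto
  then have "(u \<longlongrightarrow> poly p (X r)) (at_right (X r))"
    using X_cell[OF r] by (intro tendsto_at_right_cell) auto
  then have "(u \<longlongrightarrow> poly p (X r)) (at_right (if i = N then X 0 else X i))"
    by (simp add: r_def split: if_splits)
  then show ?thesis using trace_right_eqI by metis
qed

lemma tendsto_trace_left:
  assumes "u \<in> dg_space X N k" "i \<le> N"
  shows "(u \<longlongrightarrow> trace_left X N u i) (at_left (if i = 0 then X N else X i))"
proof -
  \<comment> \<open>The cell to the left of interface \<open>i\<close> has index \<open>r\<close>;
    at \<open>i = 0\<close> this is the last cell.\<close>
  define r where "r = (if i = 0 then N else i)"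
  have r: "r \<in> {1..N}" using assms(2) N_pos by (auto simp: r_def)
  obtain p where "\<And>x. x \<in> {X (r - 1)<..<X r} \<Longrightarrow> u x = poly p x"
    using dg_space_cellE[OF assms(1) r] by auto
  then have "(u \<longlongrightarrow> poly p (X r)) (at_left (X r))"
    using X_cell[OF r] by (intro tendsto_at_left_cell) auto
  then have "(u \<longlongrightarrow> poly p (X r)) (at_left (if i = 0 then X N else X i))"
    by (simp add: r_def split: if_splits)
  then show ?thesis using trace_left_eqI by metis
qed

lemma trace_lincomb:
  assumes "u \<in> dg_space X N k" "v \<in> dg_space X N l" "i \<le> N"
  shows "trace_right X N (\<lambda>x. a * u x + b * v x) i
           = a * trace_right X N u i + b * trace_right X N v i"
    and "trace_left X N (\<lambda>x. a * u x + b * v x) i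
           = a * trace_left X N u i + b * trace_left X N v i"
  by (intro trace_right_eqI trace_left_eqI tendsto_intros
      tendsto_trace_right[OF assms(1,3)] tendsto_trace_right[OF assms(2,3)]
      tendsto_trace_left[OF assms(1,3)] tendsto_trace_left[OF assms(2,3)])+

lemma trace_mult:
  assumes "u \<in> dg_space X N k" "v \<in> dg_space X N l" "i \<le> N"
  shows "trace_right X N (\<lambda>x. u x * v x) i = trace_right X N u i * trace_right X N v i"
    and "trace_left X N (\<lambda>x. u x * v x) i = trace_left X N u i * trace_left X N v i"
  by (intro trace_right_eqI trace_left_eqI tendsto_intros
      tendsto_trace_right[OF assms(1,3)] tendsto_trace_right[OF assms(2,3)]
      tendsto_trace_left[OF assms(1,3)] tendsto_trace_left[OF assms(2,3)])+

lemma trace_const: "trace_right X N (\<lambda>x. c) i = c" "trace_left X N (\<lambda>x. c) i = c"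
  by (rule trace_right_eqI trace_left_eqI; simp)+

lemma jump_const: "jump X N (\<lambda>x. c) i = 0"
  by (simp add: jump_def trace_const)

lemma jump_avg_lincomb:
  assumes "u \<in> dg_space X N k" "v \<in> dg_space X N l" "i \<le> N"
  shows "jump X N (\<lambda>x. a * u x + b * v x) i = a * jump X N u i + b * jump X N v i"
    and "avg X N (\<lambda>x. a * u x + b * v x) i = a * avg X N u i + b * avg X N v i"
  using assms by (simp_all add: jump_def avg_def trace_lincomb field_simps)

text \<open>A product rule for jumps: after expanding the averages, the mixed products of left and
  right traces cancel. All interface terms in the integration by parts come from it.\<close>

lemma jump_mult:
  assumes "u \<in> dg_space X N k" "v \<in> dg_space X N l" "i \<le> N"
  shows "jump X N (\<lambda>x. u x * v x) i
           = avg X N u i * jump X N v i + jump X N u i * avg X N v i"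
  using assms by (simp add: jump_def avg_def trace_mult field_simps)

section \<open>Periodicity and sums over interfaces\<close>

lemma periodic:
  "trace_right X N u 0 = trace_right X N u N" "trace_left X N u 0 = trace_left X N u N"
  "jump X N u 0 = jump X N u N" "avg X N u 0 = avg X N u N"
  "flux_E X N \<beta> E \<Phi> 0 = flux_E X N \<beta> E \<Phi> N" "flux_Phi X N \<Phi> 0 = flux_Phi X N \<Phi> N"
  "flux_g X N vth NH D n 0 = flux_g X N vth NH D n N"
  "flux_C1 X N vth NH D 0 = flux_C1 X N vth NH D N"
  by (simp_all add: trace_right_def trace_left_def jump_def avg_def flux_E_def flux_Phi_def
      flux_g_def flux_C1_def)

lemma sum_shift:
  fixes f :: "nat \<Rightarrow> real"
  assumes "f 0 = f N"
  shows "(\<Sum>j=1..N. f (j - 1)) = (\<Sum>j=1..N. f j)"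
proof -
  have "(\<Sum>j=1..N. f j - f (j - 1)) = f N - f 0"
    by (induction N) auto
  then show ?thesis using assms by (simp add: sum_subtractf)
qed

text \<open>A flux is single-valued at an interface, so reindexing the right traces pairs them with
  the left traces of the neighbouring cell. Only \<open>F\<close> needs a periodicity assumption,
  because traces are periodic by definition.\<close>

lemma sum_flux_traces:
  assumes "F 0 = F N"
  shows "(\<Sum>j=1..N. F j * trace_left X N u j - F (j - 1) * trace_right X N u (j - 1))
           = - (\<Sum>j=1..N. F j * jump X N u j)"
proof -
  have "(\<Sum>j=1..N. F (j - 1) * trace_right X N u (j - 1))
      = (\<Sum>j=1..N. F j * trace_right X N u j)"
    by (rule sum_shift[where f = "\<lambda>j. F j * trace_right X N u j"]) (simp add: assms periodic)
  then show ?thesis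
    by (simp add: sum_subtractf jump_def algebra_simps)
qed

section \<open>Integration over cells and by parts\<close>

lemma dg_space_integrable_cell:
  assumes "u \<in> dg_space X N k" "j \<in> {1..N}"
  shows "u integrable_on {X (j - 1)..X j}"
proof -
  obtain p where p: "\<And>x. x \<in> {X (j - 1)<..<X j} \<Longrightarrow> u x = poly p x"
    using dg_space_cellE[OF assms] by metis
  have "poly p integrable_on {X (j - 1)..X j}"
    by (intro integrable_continuous_interval continuous_intros)
  then show ?thesis
    by (rule integrable_spike_finite[of "{X (j - 1), X j}", rotated 2]) (use p in auto)
qed

text \<open>Induction over the number of cells; \<open>0 \<le> X n\<close> is carried along because
  combining two intervals requires ordered endpoints.\<close>

lemma dg_space_has_integral:
  assumes "u \<in> dg_space X N k" "n \<le> N"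
  shows "(u has_integral (\<Sum>j=1..n. integral {X (j - 1)..X j} u)) {0..X n} \<and> 0 \<le> X n"
  using assms(2)
proof (induction n)
  case 0
  then show ?case by (simp add: X_0 has_integral_refl)
next
  case (Suc n)
  let ?S = "\<Sum>j=1..n. integral {X (j - 1)..X j} u"
  have le: "X n \<le> X (Suc n)"
    using X_Suc[of n] Suc.prems by simp
  have IH: "(u has_integral ?S) {0..X n}" "0 \<le> X n"
    using Suc by simp_all
  have "u integrable_on {X n..X (Suc n)}"
    using dg_space_integrable_cell[OF assms(1), of "Suc n"] Suc.prems by simp
  from has_integral_combine[OF IH(2) le IH(1) integrable_integral[OF this]]
  show ?case
    using order_trans[OF IH(2) le] by simp
qed

lemma dg_space_integrable: "u \<in> dg_space X N k \<Longrightarrow> u integrable_on {0..L}"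
  using dg_space_has_integral[of u k N] X_N by auto

lemma integral_cells:
  "u \<in> dg_space X N k \<Longrightarrow> (\<Sum>j=1..N. integral {X (j - 1)..X j} u) = integral {0..L} u"
  using dg_space_has_integral[of u k N] X_N by (auto dest: integral_unique)

lemma integral_lincomb:
  assumes "u \<in> dg_space X N k" "v \<in> dg_space X N l"
  shows "integral {0..L} (\<lambda>x. a * u x + b * v x) = a * integral {0..L} u + b * integral {0..L} v"
  using assms[THEN dg_space_integrable] by (rule integral_real_lincomb)

lemma integral_cell_lincomb:
  assumes "u \<in> dg_space X N k" "v \<in> dg_space X N l" "j \<in> {1..N}"
  shows "integral {X (j - 1)..X j} (\<lambda>x. a * u x + b * v x)
           = a * integral {X (j - 1)..X j} u + b * integral {X (j - 1)..X j} v"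
  using assms(1,2)[THEN dg_space_integrable_cell, OF assms(3)] by (rule integral_real_lincomb)

text \<open>Inside the cell the integrand is the derivative of the polynomial \<open>p * q\<close>,
  so the fundamental theorem of calculus applies after discarding the two endpoints.\<close>

lemma integral_cell_deriv_mult:
  assumes "u \<in> dg_space X N k" "v \<in> dg_space X N l" "j \<in> {1..N}"
  shows "integral {X (j - 1)..X j} (\<lambda>x. u x * deriv v x + deriv u x * v x)
           = trace_left X N u j * trace_left X N v j
             - trace_right X N u (j - 1) * trace_right X N v (j - 1)"
proof -
  let ?a = "X (j - 1)" and ?b = "X j"
  have ab: "?a < ?b" using X_cell[OF assms(3)] .
  obtain p where p: "\<And>x. x \<in> {?a<..<?b} \<Longrightarrow> u x = poly p x"
    using dg_space_cellE[OF assms(1,3)] by metis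
  obtain q where q: "\<And>x. x \<in> {?a<..<?b} \<Longrightarrow> v x = poly q x"
    using dg_space_cellE[OF assms(2,3)] by metis
  \<comment> \<open>Excludes the periodic branches of both traces, so they are taken at the ends of
    this very cell.\<close>
  have j: "j \<noteq> 0" "j - 1 \<noteq> N" using assms(3) by auto
  have lim: "(u \<longlongrightarrow> poly p ?b) (at_left ?b)" "(v \<longlongrightarrow> poly q ?b) (at_left ?b)"
    "(u \<longlongrightarrow> poly p ?a) (at_right ?a)" "(v \<longlongrightarrow> poly q ?a) (at_right ?a)"
    by (rule tendsto_at_left_cell tendsto_at_right_cell, erule p q, rule ab)+
  have tr: "trace_left X N u j = poly p ?b" "trace_left X N v j = poly q ?b"
    "trace_right X N u (j - 1) = poly p ?a" "trace_right X N v (j - 1) = poly q ?a"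
    using lim trace_left_eqI[of _ _ j] trace_right_eqI[of _ _ "j - 1"] j by simp_all
  have FTC: "(poly (pderiv (p * q)) has_integral poly (p * q) ?b - poly (p * q) ?a) {?a..?b}"
  proof (rule fundamental_theorem_of_calculus)
    show "?a \<le> ?b" using ab by simp
    show "(poly (p * q) has_vector_derivative poly (pderiv (p * q)) x) (at x within {?a..?b})" for x
      using has_field_derivative_at_within[OF poly_DERIV[of "p * q" x]]
      by (simp only: has_real_derivative_iff_has_vector_derivative)
  qed
  have "u x * deriv v x + deriv u x * v x = poly (pderiv (p * q)) x"
    if "x \<in> {?a<..<?b}" for x
  proof -
    have "deriv u x = poly (pderiv p) x" "deriv v x = poly (pderiv q) x"
      by (rule deriv_eq_pderiv(2)[OF _ that], erule p q)+
    then show ?thesis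
      using p[OF that] q[OF that] by (simp add: pderiv_mult)
  qed
  then have "((\<lambda>x. u x * deriv v x + deriv u x * v x)
      has_integral poly (p * q) ?b - poly (p * q) ?a) {?a..?b}"
    by (intro has_integral_spike_finite[OF _ _ FTC, of "{?a, ?b}"]) auto
  then show ?thesis by (simp add: tr integral_unique)
qed

text \<open>Summing the boundary values of all cells leaves only the jumps of the product, which
  \<open>jump_mult\<close> splits.\<close>

lemma integral_by_parts:
  assumes "u \<in> dg_space X N k" "v \<in> dg_space X N l"
  shows "integral {0..L} (\<lambda>x. u x * deriv v x) + integral {0..L} (\<lambda>x. deriv u x * v x)
           = - (\<Sum>j=1..N. avg X N u j * jump X N v j + jump X N u j * avg X N v j)"
proof -
  note d = dg_space_mult[OF assms(1) dg_space_deriv[OF assms(2)]]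
    dg_space_mult[OF dg_space_deriv[OF assms(1)] assms(2)]
  have "integral {0..L} (\<lambda>x. u x * deriv v x) + integral {0..L} (\<lambda>x. deriv u x * v x)
      = integral {0..L} (\<lambda>x. u x * deriv v x + deriv u x * v x)"
    using integral_lincomb[OF d, of 1 1] by simp
  also have "\<dots> = (\<Sum>j=1..N. integral {X (j - 1)..X j} (\<lambda>x. u x * deriv v x + deriv u x * v x))"
    using integral_cells[OF dg_space_lincomb[OF d, of 1 1]] by simp
  \<comment> \<open>The factors \<open>1\<close> present the boundary values as traces weighted by a
    constant flux, the shape required by \<open>sum_flux_traces\<close>.\<close>
  also have "\<dots> = (\<Sum>j=1..N. 1 * trace_left X N (\<lambda>x. u x * v x) j
                      - 1 * trace_right X N (\<lambda>x. u x * v x) (j - 1))"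
    by (intro sum.cong refl) (auto simp: integral_cell_deriv_mult[OF assms] trace_mult[OF assms])
  also have "\<dots> = - (\<Sum>j=1..N. jump X N (\<lambda>x. u x * v x) j)"
    using sum_flux_traces[of "\<lambda>_. 1" "\<lambda>x. u x * v x"] by simp
  also have "\<dots> = - (\<Sum>j=1..N. avg X N u j * jump X N v j + jump X N u j * avg X N v j)"
    by (simp add: jump_mult[OF assms])
  finally show ?thesis .
qed

section \<open>The discrete Poisson problem in global form\<close>

text \<open>Integration by parts moves the derivative from \<open>\<eta>\<close> to
  \<open>\<Phi>\<close>. The central flux then cancels the terms with the average of
  \<open>\<Phi>\<close> and the jump of \<open>\<eta>\<close>.\<close>

lemma poisson_E_eq:
  assumes P: "discrete_poisson X N k vth \<rho> \<beta> D E \<Phi>" and "\<eta> \<in> dg_space X N k"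
  shows "integral {0..L} (\<lambda>x. E x * \<eta> x)
           = - integral {0..L} (\<lambda>x. \<eta> x * deriv \<Phi> x) - (\<Sum>j=1..N. jump X N \<Phi> j * avg X N \<eta> j)"
proof -
  have d: "E \<in> dg_space X N k" "\<Phi> \<in> dg_space X N k"
    using P by (auto simp: discrete_poisson_def)
  note m = dg_space_mult[OF d(2) dg_space_deriv[OF assms(2)]] dg_space_mult[OF d(1) assms(2)]
  have "(\<Sum>j=1..N. integral {X (j - 1)..X j} (\<lambda>x. E x * \<eta> x))
     = (\<Sum>j=1..N. integral {X (j - 1)..X j} (\<lambda>x. \<Phi> x * deriv \<eta> x)
         - (flux_Phi X N \<Phi> j * trace_left X N \<eta> j
            - flux_Phi X N \<Phi> (j - 1) * trace_right X N \<eta> (j - 1)))"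
    using P assms(2) unfolding discrete_poisson_def by (intro sum.cong refl) fastforce
  also have "\<dots> = integral {0..L} (\<lambda>x. \<Phi> x * deriv \<eta> x)
      + (\<Sum>j=1..N. flux_Phi X N \<Phi> j * jump X N \<eta> j)"
    by (subst sum_subtractf)
      (simp add: sum_flux_traces[of "flux_Phi X N \<Phi>", OF periodic(6)] integral_cells[OF m(1)])
  finally show ?thesis
    using integral_by_parts[OF d(2) assms(2)]
    by (simp add: integral_cells[OF m(2)] flux_Phi_def sum.distrib mult.commute)
qed

text \<open>Here the derivative stays on \<open>\<zeta>\<close>; with \<open>\<zeta>\<close> a
  potential, the volume term can be matched with that of \<open>poisson_E_eq\<close>.\<close>

lemma poisson_Phi_eq:
  assumes P: "discrete_poisson X N k vth \<rho> \<beta> D E \<Phi>" and "D \<in> dg_space X N k"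
    and "\<zeta> \<in> dg_space X N k"
  shows "integral {0..L} (\<lambda>x. (vth * D x - \<rho>) * \<zeta> x)
           = - integral {0..L} (\<lambda>x. E x * deriv \<zeta> x)
             - (\<Sum>j=1..N. flux_E X N \<beta> E \<Phi> j * jump X N \<zeta> j)"
proof -
  have d: "E \<in> dg_space X N k"
    using P by (auto simp: discrete_poisson_def)
  have src: "(\<lambda>x. vth * D x - \<rho>) \<in> dg_space X N k"
    using dg_space_lincomb[OF assms(2) dg_space_const[of 1], of vth "- \<rho>"] by simp
  note m = dg_space_mult[OF d dg_space_deriv[OF assms(3)]] dg_space_mult[OF src assms(3)]
  have "(\<Sum>j=1..N. integral {X (j - 1)..X j} (\<lambda>x. (vth * D x - \<rho>) * \<zeta> x))
     = (\<Sum>j=1..N. (flux_E X N \<beta> E \<Phi> j * trace_left X N \<zeta> j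
            - flux_E X N \<beta> E \<Phi> (j - 1) * trace_right X N \<zeta> (j - 1))
          - integral {X (j - 1)..X j} (\<lambda>x. E x * deriv \<zeta> x))"
    using P assms(3) unfolding discrete_poisson_def by (intro sum.cong refl) fastforce
  also have "\<dots> = - integral {0..L} (\<lambda>x. E x * deriv \<zeta> x)
      - (\<Sum>j=1..N. flux_E X N \<beta> E \<Phi> j * jump X N \<zeta> j)"
    by (subst sum_subtractf)
      (simp add: sum_flux_traces[of "flux_E X N \<beta> E \<Phi>", OF periodic(5)] integral_cells[OF m(1)])
  finally show ?thesis by (simp add: integral_cells[OF m(2)])
qed

text \<open>The background density enters affinely and is therefore combined as well: time
  differences have background \<open>0\<close>, time means keep \<open>\<rho>\<close>.\<close>

lemma discrete_poisson_lincomb: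
  assumes P: "discrete_poisson X N k vth \<rho> \<beta> D E \<Phi>" and P': "discrete_poisson X N k vth \<rho>' \<beta> D' E' \<Phi>'"
    and D: "D \<in> dg_space X N k" "D' \<in> dg_space X N k"
  shows "discrete_poisson X N k vth (a * \<rho> + b * \<rho>') \<beta> (\<lambda>x. a * D x + b * D' x)
           (\<lambda>x. a * E x + b * E' x) (\<lambda>x. a * \<Phi> x + b * \<Phi>' x)"
proof -
  have d: "E \<in> dg_space X N k" "\<Phi> \<in> dg_space X N k" "E' \<in> dg_space X N k" "\<Phi>' \<in> dg_space X N k"
    using P P' by (auto simp: discrete_poisson_def)
  have lin: "integral {X (j - 1)..X j} (\<lambda>x. (a * u x + b * v x) * w x)
      = a * integral {X (j - 1)..X j} (\<lambda>x. u x * w x) + b * integral {X (j - 1)..X j} (\<lambda>x. v x * w x)"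
    if "u \<in> dg_space X N k" "v \<in> dg_space X N k" "w \<in> dg_space X N k" "j \<in> {1..N}" for u v w j
    using integral_cell_lincomb[OF dg_space_mult[OF that(1,3)] dg_space_mult[OF that(2,3)] that(4)]
    by (simp add: algebra_simps)
  have src: "(\<lambda>x. vth * D x - \<rho>) \<in> dg_space X N k" "(\<lambda>x. vth * D' x - \<rho>') \<in> dg_space X N k"
    using dg_space_lincomb[OF D(1) dg_space_const[of 1], of vth "- \<rho>"]
      dg_space_lincomb[OF D(2) dg_space_const[of 1], of vth "- \<rho>'"] by simp_all
  have src_eq: "vth * (a * D x + b * D' x) - (a * \<rho> + b * \<rho>')
      = a * (vth * D x - \<rho>) + b * (vth * D' x - \<rho>')" for x
    by (simp add: algebra_simps)
  show ?thesis
    unfolding discrete_poisson_def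
  proof (intro conjI ballI)
    fix j \<eta> \<zeta> assume j: "j \<in> {1..N}" and \<eta>: "\<eta> \<in> dg_space X N k" and \<zeta>: "\<zeta> \<in> dg_space X N k"
    have le: "j \<le> N" "j - 1 \<le> N" using j by auto
    note eqs = P[unfolded discrete_poisson_def, THEN conjunct2, THEN conjunct2, rule_format, OF j \<eta> \<zeta>]
      P'[unfolded discrete_poisson_def, THEN conjunct2, THEN conjunct2, rule_format, OF j \<eta> \<zeta>]
    show "integral {X (j - 1)..X j} (\<lambda>x. (a * \<Phi> x + b * \<Phi>' x) * deriv \<eta> x)
          - flux_Phi X N (\<lambda>x. a * \<Phi> x + b * \<Phi>' x) j * trace_left X N \<eta> j
          + flux_Phi X N (\<lambda>x. a * \<Phi> x + b * \<Phi>' x) (j - 1) * trace_right X N \<eta> (j - 1)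
          = integral {X (j - 1)..X j} (\<lambda>x. (a * E x + b * E' x) * \<eta> x)"
      unfolding lin[OF d(2,4) dg_space_deriv[OF \<eta>] j] lin[OF d(1,3) \<eta> j]
        flux_Phi_def jump_avg_lincomb(2)[OF d(2,4) le(1)] jump_avg_lincomb(2)[OF d(2,4) le(2)]
        eqs(1)[THEN conjunct1, symmetric] eqs(2)[THEN conjunct1, symmetric]
      by (simp add: algebra_simps)
    show "- integral {X (j - 1)..X j} (\<lambda>x. (a * E x + b * E' x) * deriv \<zeta> x)
          + flux_E X N \<beta> (\<lambda>x. a * E x + b * E' x) (\<lambda>x. a * \<Phi> x + b * \<Phi>' x) j * trace_left X N \<zeta> j
          - flux_E X N \<beta> (\<lambda>x. a * E x + b * E' x) (\<lambda>x. a * \<Phi> x + b * \<Phi>' x) (j - 1)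
              * trace_right X N \<zeta> (j - 1)
          = integral {X (j - 1)..X j}
              (\<lambda>x. (vth * (a * D x + b * D' x) - (a * \<rho> + b * \<rho>')) * \<zeta> x)"
      unfolding src_eq lin[OF d(1,3) dg_space_deriv[OF \<zeta>] j] lin[OF src \<zeta> j]
        flux_E_def jump_avg_lincomb[OF d(2,4) le(1)] jump_avg_lincomb[OF d(2,4) le(2)]
        jump_avg_lincomb[OF d(1,3) le(1)] jump_avg_lincomb[OF d(1,3) le(2)]
        eqs(1)[THEN conjunct2, symmetric] eqs(2)[THEN conjunct2, symmetric]
      by (simp add: algebra_simps)
  qed (intro dg_space_lincomb d)+
qed

text \<open>With \<open>\<eta> = 1\<close> the right-hand side consists of the integrated slopes and
  the jumps of \<open>\<Phi>\<close>, which cancel over a period.\<close>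

lemma poisson_integral_E:
  assumes "discrete_poisson X N k vth \<rho> \<beta> D E \<Phi>"
  shows "integral {0..L} E = 0"
proof -
  have \<Phi>: "\<Phi> \<in> dg_space X N k" using assms by (auto simp: discrete_poisson_def)
  show ?thesis
    using poisson_E_eq[OF assms dg_space_const[of 1]] integral_by_parts[OF dg_space_const[of 1 k] \<Phi>]
    by (simp add: jump_const avg_def trace_const sum_negf)
qed

text \<open>With \<open>\<zeta> = E\<close>, the integral of \<open>E\<close> times its derivative
  cancels the central part of the flux, and the background drops out because \<open>E\<close> has
  mean zero. Only the penalty part of the flux survives.\<close>

lemma poisson_force:
  assumes P: "discrete_poisson X N k vth \<rho> \<beta> D E \<Phi>" and D: "D \<in> dg_space X N k"
  shows "vth * integral {0..L} (\<lambda>x. E x * D x) = \<beta> * (\<Sum>j=1..N. jump X N \<Phi> j * jump X N E j)"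
proof -
  have E: "E \<in> dg_space X N k" using P by (auto simp: discrete_poisson_def)
  have "integral {0..L} (\<lambda>x. E x * deriv E x) = - (\<Sum>j=1..N. avg X N E j * jump X N E j)"
    using integral_by_parts[OF E E] by (simp add: mult.commute flip: sum_distrib_left)
  moreover have "integral {0..L} (\<lambda>x. (vth * D x - \<rho>) * E x)
      = vth * integral {0..L} (\<lambda>x. E x * D x) - \<rho> * integral {0..L} E"
    using integral_lincomb[OF dg_space_mult[OF E D] E, of vth "- \<rho>"] by (simp add: algebra_simps)
  moreover have "(\<Sum>j=1..N. flux_E X N \<beta> E \<Phi> j * jump X N E j)
      = (\<Sum>j=1..N. avg X N E j * jump X N E j) - \<beta> * (\<Sum>j=1..N. jump X N \<Phi> j * jump X N E j)"
    by (simp add: flux_E_def left_diff_distrib sum_subtractf sum_distrib_left mult.assoc)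
  ultimately show ?thesis
    unfolding poisson_Phi_eq[OF P D E] poisson_integral_E[OF P] by linarith
qed

section \<open>Transport and source terms\<close>

lemma dg_space_transport:
  assumes "\<And>n. n < NH \<Longrightarrow> D n \<in> dg_space X N k" "n < NH"
  shows "transport vth NH D n \<in> dg_space X N k"
proof -
  define up down where "up = (\<lambda>x. if n + 1 < NH then D (n + 1) x else 0)"
    and "down = (\<lambda>x. if n = 0 then 0 else D (n - 1) x)"
  have "up \<in> dg_space X N k"
    using assms(1)[of "n + 1"] by (cases "n + 1 < NH") (simp_all add: up_def dg_space_const)
  moreover have "down \<in> dg_space X N k"
    using assms(1)[of "n - 1"] assms(2) by (cases "n = 0") (simp_all add: down_def dg_space_const)
  moreover have "transport vth NH D n
      = (\<lambda>x. vth * sqrt (real n + 1) * up x + vth * sqrt (real n) * down x)"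
    unfolding transport_def up_def down_def by (simp only: distrib_left mult.assoc)
  ultimately show ?thesis
    by (simp only: dg_space_lincomb)
qed

lemma a_form_eq:
  assumes "transport vth NH D n \<in> dg_space X N k" "\<phi> \<in> dg_space X N k"
  shows "a_form X N vth NH D n \<phi>
           = - integral {0..L} (\<lambda>x. transport vth NH D n x * deriv \<phi> x)
             - (\<Sum>j=1..N. flux_g X N vth NH D n j * jump X N \<phi> j)"
  unfolding a_form_def add_diff_eq[symmetric] sum.distrib
  by (simp add: sum_flux_traces[of "flux_g X N vth NH D n", OF periodic(7)] sum_negf
      integral_cells[OF dg_space_mult[OF assms(1) dg_space_deriv[OF assms(2)]]])

lemma a_form_const:
  assumes "transport vth NH D n \<in> dg_space X N k"
  shows "a_form X N vth NH D n (\<lambda>x. 1) = 0"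
  by (simp add: a_form_eq[OF assms dg_space_const] jump_const)

text \<open>\<open>r1_term\<close> places half of the penalty contribution on each side of an
  interface. Summed over the periodic mesh, the halves add up to the force computed in
  \<open>poisson_force\<close>.\<close>

lemma b_form_1_const:
  assumes P: "discrete_poisson X N k vth \<rho> \<beta> (D 0) E \<Phi>" and D: "D 0 \<in> dg_space X N k"
    and vth: "vth > 0"
  shows "b_form X N vth NH \<beta> 1 D E \<Phi> (\<lambda>x. 1) = 0"
proof -
  let ?f = "\<lambda>j. jump X N \<Phi> j * jump X N E j"
  have E: "E \<in> dg_space X N k" using P by (auto simp: discrete_poisson_def)
  have shift: "(\<Sum>j=1..N. ?f (j - 1)) = (\<Sum>j=1..N. ?f j)"
    by (rule sum_shift) (simp add: periodic)
  have "b_form X N vth NH \<beta> 1 D E \<Phi> (\<lambda>x. 1)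
      = - (1 / vth) * (\<Sum>j=1..N. integral {X (j - 1)..X j} (\<lambda>x. E x * D 0 x))
        + \<beta> / (2 * vth ^ 2) * ((\<Sum>j=1..N. ?f (j - 1)) + (\<Sum>j=1..N. ?f j))"
    unfolding b_form_def b_cell_def r1_term_def sum_distrib_left sum.distrib[symmetric]
    by (intro sum.cong) (auto simp: trace_const algebra_simps)
  also have "\<dots> = - (1 / vth) * integral {0..L} (\<lambda>x. E x * D 0 x)
      + \<beta> / vth ^ 2 * (\<Sum>j=1..N. ?f j)"
    unfolding integral_cells[OF dg_space_mult[OF E D]] shift
    by (simp add: field_simps)
  also have "\<dots> = - (1 / vth ^ 2) * (vth * integral {0..L} (\<lambda>x. E x * D 0 x)
      - \<beta> * (\<Sum>j=1..N. ?f j))"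
    using vth by (simp add: field_simps power2_eq_square)
  finally show ?thesis using poisson_force[OF P D] by simp
qed

text \<open>The prefactor \<open>sqrt 2 * vth\<close> clears all denominators. The second factor
  \<open>2\<close> arises because the two sides of each interface contribute equal sums.\<close>

lemma b_form_2_const:
  assumes E: "E \<in> dg_space X N k" and D: "D 1 \<in> dg_space X N k" and vth: "vth > 0"
  shows "sqrt 2 * vth * b_form X N vth NH \<beta> 2 D E \<Phi> (\<lambda>x. 1)
           = - 2 * integral {0..L} (\<lambda>x. E x * D 1 x)
             - 2 * (\<Sum>j=1..N. (avg X N (D 1) j - flux_C1 X N vth NH D j) * jump X N \<Phi> j)"
proof -
  let ?f = "\<lambda>j. (avg X N (D 1) j - flux_C1 X N vth NH D j) * jump X N \<Phi> j"
  have r2: "sqrt 2 * (sqrt 2 * z) = 2 * z" for z :: real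
    by (simp flip: mult.assoc)
  have "sqrt 2 * vth * b_form X N vth NH \<beta> 2 D E \<Phi> (\<lambda>x. 1)
      = - 2 * (\<Sum>j=1..N. integral {X (j - 1)..X j} (\<lambda>x. E x * D 1 x))
        - ((\<Sum>j=1..N. ?f (j - 1)) + (\<Sum>j=1..N. ?f j))"
    unfolding b_form_def b_cell_def r2_term_def sum_distrib_left sum.distrib[symmetric]
      sum_subtractf[symmetric]
    using vth by (intro sum.cong) (auto simp: trace_const field_simps One_nat_def r2)
  moreover have "(\<Sum>j=1..N. ?f (j - 1)) = (\<Sum>j=1..N. ?f j)"
    by (rule sum_shift) (simp add: periodic)
  ultimately show ?thesis
    by (simp add: integral_cells[OF dg_space_mult[OF E D]])
qed

section \<open>Exchange between electric and kinetic energy\<close>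

text \<open>A difference of squares is twice the mean times the difference, which is why the
  potential appears averaged over both time levels.\<close>

lemma electric_energy_increment:
  assumes P: "discrete_poisson X N k vth \<rho> \<beta> D E \<Phi>" and P': "discrete_poisson X N k vth \<rho> \<beta> D' E' \<Phi>'"
    and D: "D \<in> dg_space X N k" "D' \<in> dg_space X N k"
  shows "1 / 2 * (integral {0..L} (\<lambda>x. E' x ^ 2) - integral {0..L} (\<lambda>x. E x ^ 2))
          + 1 / 2 * \<beta> * ((\<Sum>j=1..N. jump X N \<Phi>' j ^ 2) - (\<Sum>j=1..N. jump X N \<Phi> j ^ 2))
         = vth * integral {0..L} (\<lambda>x. (D' x - D x) * ((\<Phi> x + \<Phi>' x) / 2))"
proof -
  define Eh \<Phi>h where "Eh = (\<lambda>x. 1 / 2 * E x + 1 / 2 * E' x)" and "\<Phi>h = (\<lambda>x. 1 / 2 * \<Phi> x + 1 / 2 * \<Phi>' x)"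
  \<comment> \<open>The coefficients \<open>- 1\<close> and \<open>1\<close> are written out to
    match the linear combination lemmas.\<close>
  define \<delta>D \<delta>E \<delta>\<Phi> where "\<delta>D = (\<lambda>x. - 1 * D x + 1 * D' x)" and "\<delta>E = (\<lambda>x. - 1 * E x + 1 * E' x)"
    and "\<delta>\<Phi> = (\<lambda>x. - 1 * \<Phi> x + 1 * \<Phi>' x)"
  have d: "E \<in> dg_space X N k" "\<Phi> \<in> dg_space X N k" "E' \<in> dg_space X N k" "\<Phi>' \<in> dg_space X N k"
    using P P' by (auto simp: discrete_poisson_def)
  have dh: "\<Phi>h \<in> dg_space X N k" "\<delta>E \<in> dg_space X N k" "\<delta>D \<in> dg_space X N k"
    unfolding \<Phi>h_def \<delta>E_def \<delta>D_def by (intro dg_space_lincomb d D)+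
  have Ph: "discrete_poisson X N k vth \<rho> \<beta> (\<lambda>x. 1 / 2 * D x + 1 / 2 * D' x) Eh \<Phi>h"
    using discrete_poisson_lincomb[OF P P' D, of "1 / 2" "1 / 2"] by (simp add: Eh_def \<Phi>h_def)
  have P\<delta>: "discrete_poisson X N k vth 0 \<beta> \<delta>D \<delta>E \<delta>\<Phi>"
    using discrete_poisson_lincomb[OF P P' D, of "- 1" 1] by (simp add: \<delta>D_def \<delta>E_def \<delta>\<Phi>_def)
  have sq: "u \<in> dg_space X N k \<Longrightarrow> (\<lambda>x. u x ^ 2) \<in> dg_space X N (k + k)" for u
    using dg_space_mult[of u k u k] by (simp add: power2_eq_square)
  have "1 / 2 * (integral {0..L} (\<lambda>x. E' x ^ 2) - integral {0..L} (\<lambda>x. E x ^ 2))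
      = integral {0..L} (\<lambda>x. 1 / 2 * E' x ^ 2 + (- 1 / 2) * E x ^ 2)"
    using integral_lincomb[OF sq[OF d(3)] sq[OF d(1)], of "1 / 2" "- 1 / 2"] by simp
  also have "\<dots> = integral {0..L} (\<lambda>x. Eh x * \<delta>E x)"
    by (simp add: Eh_def \<delta>E_def power2_eq_square field_simps)
  finally have field: "1 / 2 * (integral {0..L} (\<lambda>x. E' x ^ 2) - integral {0..L} (\<lambda>x. E x ^ 2))
      = integral {0..L} (\<lambda>x. Eh x * \<delta>E x)" .
  have jump_h: "jump X N \<Phi>h j = 1 / 2 * jump X N \<Phi> j + 1 / 2 * jump X N \<Phi>' j"
    and jump_\<delta>: "jump X N \<delta>\<Phi> j = - 1 * jump X N \<Phi> j + 1 * jump X N \<Phi>' j" if "j \<le> N" for j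
    unfolding \<Phi>h_def \<delta>\<Phi>_def by (rule jump_avg_lincomb(1)[OF d(2,4) that])+
  have jumps: "1 / 2 * ((\<Sum>j=1..N. jump X N \<Phi>' j ^ 2) - (\<Sum>j=1..N. jump X N \<Phi> j ^ 2))
      = (\<Sum>j=1..N. jump X N \<delta>\<Phi> j * jump X N \<Phi>h j)"
    unfolding sum_subtractf[symmetric] sum_distrib_left
    by (intro sum.cong refl)
      (simp add: jump_h jump_\<delta> power2_eq_square field_simps)
  \<comment> \<open>The first Poisson equation of the mean is tested with \<open>\<delta>E\<close>,
    the second one of the difference with \<open>\<Phi>h\<close>. The volume and average terms
    agree, and the penalty in \<open>flux_E\<close> supplies the jump term.\<close>
  have "integral {0..L} (\<lambda>x. Eh x * \<delta>E x) + \<beta> * (\<Sum>j=1..N. jump X N \<delta>\<Phi> j * jump X N \<Phi>h j)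
      = integral {0..L} (\<lambda>x. (vth * \<delta>D x - 0) * \<Phi>h x)"
    unfolding poisson_E_eq[OF Ph dh(2)] poisson_Phi_eq[OF P\<delta> dh(3,1)] flux_E_def
    by (simp add: algebra_simps sum_subtractf sum_distrib_left)
  also have "\<dots> = vth * integral {0..L} (\<lambda>x. \<delta>D x * \<Phi>h x)"
    by (simp add: mult.assoc)
  also have "(\<lambda>x. \<delta>D x * \<Phi>h x) = (\<lambda>x. (D' x - D x) * ((\<Phi> x + \<Phi>' x) / 2))"
    by (simp add: \<delta>D_def \<Phi>h_def fun_eq_iff field_simps)
  finally have main: "integral {0..L} (\<lambda>x. Eh x * \<delta>E x) + \<beta> * (\<Sum>j=1..N. jump X N \<delta>\<Phi> j * jump X N \<Phi>h j)
      = vth * integral {0..L} (\<lambda>x. (D' x - D x) * ((\<Phi> x + \<Phi>' x) / 2))" .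
  have "1 / 2 * \<beta> * ((\<Sum>j=1..N. jump X N \<Phi>' j ^ 2) - (\<Sum>j=1..N. jump X N \<Phi> j ^ 2))
      = \<beta> * (\<Sum>j=1..N. jump X N \<delta>\<Phi> j * jump X N \<Phi>h j)"
    unfolding jumps[symmetric] by simp
  then show ?thesis using field main by linarith
qed

text \<open>Testing the first Poisson equation with \<open>D 1\<close> turns the work of the field
  into a pairing with the derivative and the jumps of \<open>\<Phi>\<close>. \<open>r2_term\<close>
  replaces the average of \<open>D 1\<close> by its numerical flux, which gives the transport term.
  The density \<open>D\<^sub>0\<close> is separate from \<open>D 0\<close> because the fields will
  be time means while \<open>D\<close> stays at the old level.\<close>

lemma energy_exchange:
  assumes P: "discrete_poisson X N k vth \<rho> \<beta> D\<^sub>0 E \<Phi>"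
    and D: "\<And>n. n < NH \<Longrightarrow> D n \<in> dg_space X N k" and NH: "NH \<ge> 3" and vth: "vth > 0"
  shows "vth ^ 3 / 2 * (sqrt 2 * b_form X N vth NH \<beta> 2 D E \<Phi> (\<lambda>x. 1))
           + vth * a_form X N vth NH D 0 \<Phi> = 0"
proof -
  have d: "E \<in> dg_space X N k" "\<Phi> \<in> dg_space X N k" "D 1 \<in> dg_space X N k"
    using P D NH by (auto simp: discrete_poisson_def)
  have tr: "transport vth NH D 0 = (\<lambda>x. vth * D 1 x)"
    using NH by (simp add: transport_def fun_eq_iff)
  have "transport vth NH D 0 \<in> dg_space X N k"
    using D NH by (intro dg_space_transport) auto
  from a_form_eq[OF this d(2)]
  have a: "a_form X N vth NH D 0 \<Phi>
      = - vth * integral {0..L} (\<lambda>x. D 1 x * deriv \<Phi> x)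
        - vth * (\<Sum>j=1..N. flux_C1 X N vth NH D j * jump X N \<Phi> j)"
    unfolding tr flux_C1_def using vth by (simp add: mult.assoc sum_distrib_left)
  have "vth ^ 3 / 2 * (sqrt 2 * b_form X N vth NH \<beta> 2 D E \<Phi> (\<lambda>x. 1))
      = vth ^ 2 / 2 * (sqrt 2 * vth * b_form X N vth NH \<beta> 2 D E \<Phi> (\<lambda>x. 1))"
    by (simp add: power2_eq_square power3_eq_cube)
  also have "\<dots> = - (vth ^ 2) * (integral {0..L} (\<lambda>x. E x * D 1 x)
      + (\<Sum>j=1..N. (avg X N (D 1) j - flux_C1 X N vth NH D j) * jump X N \<Phi> j))"
    unfolding b_form_2_const[of E k D vth NH \<beta> \<Phi>, OF d(1,3) vth] by (simp add: algebra_simps)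
  finally have b: "vth ^ 3 / 2 * (sqrt 2 * b_form X N vth NH \<beta> 2 D E \<Phi> (\<lambda>x. 1))
      = - (vth ^ 2) * (integral {0..L} (\<lambda>x. E x * D 1 x)
        + (\<Sum>j=1..N. (avg X N (D 1) j - flux_C1 X N vth NH D j) * jump X N \<Phi> j))" .
  show ?thesis
    unfolding a b poisson_E_eq[OF P d(3)]
    by (simp add: algebra_simps sum_subtractf power2_eq_square)
qed

lemma total_energy_eq:
  assumes "D 0 \<in> dg_space X N k" "D 2 \<in> dg_space X N k" "E \<in> dg_space X N k"
  shows "total_energy X N L vth \<beta> D E \<Phi>
          = vth ^ 3 / 2 * (sqrt 2 * integral {0..L} (D 2) + integral {0..L} (D 0))
            + 1 / 2 * integral {0..L} (\<lambda>x. E x ^ 2) + 1 / 2 * \<beta> * (\<Sum>j=1..N. jump X N \<Phi> j ^ 2)"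
proof -
  note s = dg_space_lincomb[OF assms(2,1), of "sqrt 2" 1]
  have "integral {0..L} (\<lambda>x. vth ^ 3 * (sqrt 2 * D 2 x + D 0 x) + \<bar>E x\<bar> ^ 2)
      = vth ^ 3 * (sqrt 2 * integral {0..L} (D 2) + integral {0..L} (D 0))
        + integral {0..L} (\<lambda>x. E x ^ 2)"
    using integral_lincomb[OF s dg_space_mult[OF assms(3,3)], of "vth ^ 3" 1]
      integral_lincomb[OF assms(2,1), of "sqrt 2" 1]
    by (simp add: power2_eq_square)
  moreover have "(\<Sum>j=1..N. jump X N \<Phi> (j - 1) ^ 2) = (\<Sum>j=1..N. jump X N \<Phi> j ^ 2)"
    by (rule sum_shift[where f = "\<lambda>j. jump X N \<Phi> j ^ 2"]) (simp add: periodic)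
  ultimately show ?thesis by (simp add: total_energy_def algebra_simps)
qed

section \<open>Time stepping and the conservation laws\<close>

text \<open>The last assumption has the literal shape of a scheme equation tested with the constant
  \<open>1\<close>; \<open>a\<close> and \<open>b\<close> stand for the transport and source
  terms.\<close>

lemma integral_increment:
  assumes "u \<in> dg_space X N k" "v \<in> dg_space X N k" and "\<Delta>t > 0"
    and "integral {0..L} (\<lambda>x. (u x - v x) * 1) / \<Delta>t + a + b = (0::real)"
  shows "integral {0..L} u - integral {0..L} v = - \<Delta>t * (a + b)"
proof -
  have "integral {0..L} u - integral {0..L} v = integral {0..L} (\<lambda>x. (u x - v x) * 1)"
    using assms(1,2)[THEN dg_space_integrable] by (simp add: integral_diff)
  also have "\<dots> / \<Delta>t = - (a + b)" using assms(4) by linarith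
  finally show ?thesis using assms(3) by (simp add: field_simps)
qed

end

theorem proposition3p3:
  fixes L vth \<rho>\<^sub>0 \<beta> \<Delta>t :: real
    and k N NH :: nat
    and X :: "nat \<Rightarrow> real"
    and C :: "nat \<Rightarrow> nat \<Rightarrow> real \<Rightarrow> real"
    and E \<Phi> :: "nat \<Rightarrow> real \<Rightarrow> real"
  assumes "L > 0" and "vth > 0" and "\<beta> > 0" and "\<Delta>t > 0" and "NH \<ge> 3"
    and "mesh X N L"
    and "\<And>m n. n < NH \<Longrightarrow> C m n \<in> dg_space X N k"
    and "\<And>m. discrete_poisson X N k vth \<rho>\<^sub>0 \<beta> (C m 0) (E m) (\<Phi> m)"
    and "\<And>m n \<phi>. n < NH \<Longrightarrow> n \<noteq> 2 \<Longrightarrow> \<phi> \<in> dg_space X N k \<Longrightarrow>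
           integral {0..L} (\<lambda>x. (C (Suc m) n x - C m n x) * \<phi> x) / \<Delta>t
             + a_form X N vth NH (C m) n \<phi>
             + b_form X N vth NH \<beta> n (C m) (E m) (\<Phi> m) \<phi> = 0"
    and "\<And>m \<phi>. \<phi> \<in> dg_space X N k \<Longrightarrow>
           integral {0..L} (\<lambda>x. (C (Suc m) 2 x - C m 2 x) * \<phi> x) / \<Delta>t
             + a_form X N vth NH (C m) 2 \<phi>
             + b_form X N vth NH \<beta> 2 (C m)
                 (\<lambda>x. (E m x + E (Suc m) x) / 2) (\<lambda>x. (\<Phi> m x + \<Phi> (Suc m) x) / 2) \<phi> = 0"
  shows "(\<forall>m. \<forall>l\<in>{0, 1}.
            vth ^ (l + 1) * integral {0..L} (C m l) = vth ^ (l + 1) * integral {0..L} (C 0 l)) \<and>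
         (\<forall>m. total_energy X N L vth \<beta> (C m) (E m) (\<Phi> m)
            = total_energy X N L vth \<beta> (C 0) (E 0) (\<Phi> 0))"
proof -
  note vth = assms(2) and \<Delta>t = assms(4) and NH = assms(5) and C = assms(7) and P = assms(8)
    and scheme = assms(9) and scheme2 = assms(10)
  interpret dg_mesh X N L by unfold_locales (rule assms(6))
  have C012: "C m 0 \<in> dg_space X N k" "C m 1 \<in> dg_space X N k" "C m 2 \<in> dg_space X N k" for m
    using C NH by auto
  have E\<Phi>: "E m \<in> dg_space X N k" "\<Phi> m \<in> dg_space X N k" for m
    using P[of m] by (auto simp: discrete_poisson_def)
  have tr: "transport vth NH (C m) n \<in> dg_space X N k" if "n < NH" for m n
    using dg_space_transport[OF C that] .
  have a0: "a_form X N vth NH (C m) n (\<lambda>x. 1) = 0" if "n < NH" for m n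
    using a_form_const[OF tr[OF that]] .
  have mass_Suc: "integral {0..L} (C (Suc m) 0) = integral {0..L} (C m 0)" for m
    using integral_increment[OF C012(1) C012(1) \<Delta>t scheme[of 0 "\<lambda>x. 1" m]] a0[of 0 m] NH
    by (simp add: dg_space_const b_form_def b_cell_def)
  have mom_Suc: "integral {0..L} (C (Suc m) 1) = integral {0..L} (C m 1)" for m
    using integral_increment[OF C012(2) C012(2) \<Delta>t scheme[of 1 "\<lambda>x. 1" m]] a0[of 1 m] NH
      b_form_1_const[where D = "C m", OF P C012(1) vth]
    by (simp add: dg_space_const)
  have moments: "integral {0..L} (C m 0) = integral {0..L} (C 0 0)"
    "integral {0..L} (C m 1) = integral {0..L} (C 0 1)" for m
    by (induction m) (simp_all only: mass_Suc mom_Suc)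
  have energy_Suc: "total_energy X N L vth \<beta> (C (Suc m)) (E (Suc m)) (\<Phi> (Suc m))
      = total_energy X N L vth \<beta> (C m) (E m) (\<Phi> m)" for m
  proof -
    let ?Eh = "\<lambda>x. (E m x + E (Suc m) x) / 2" and ?\<Phi>h = "\<lambda>x. (\<Phi> m x + \<Phi> (Suc m) x) / 2"
    have half: "(\<lambda>x. 1 / 2 * u x + 1 / 2 * v x) = (\<lambda>x. (u x + v x) / 2)" for u v :: "real \<Rightarrow> real"
      by (simp add: add_divide_distrib)
    have Ph: "discrete_poisson X N k vth (1 / 2 * \<rho>\<^sub>0 + 1 / 2 * \<rho>\<^sub>0) \<beta>
        (\<lambda>x. 1 / 2 * C m 0 x + 1 / 2 * C (Suc m) 0 x) ?Eh ?\<Phi>h"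
      using discrete_poisson_lincomb[OF P[of m] P[of "Suc m"] C012(1) C012(1), of "1 / 2" "1 / 2"]
      unfolding half[of "E m"] half[of "\<Phi> m"] .
    then have \<Phi>h: "?\<Phi>h \<in> dg_space X N k" by (auto simp: discrete_poisson_def)
    \<comment> \<open>As in the scheme, \<open>?b\<close> combines the old coefficients with the
      mean fields; \<open>?a\<close> tests the old transport term with the mean potential.\<close>
    let ?b = "b_form X N vth NH \<beta> 2 (C m) ?Eh ?\<Phi>h (\<lambda>x. 1)" and ?a = "a_form X N vth NH (C m) 0 ?\<Phi>h"
    have "integral {0..L} (C (Suc m) 2) - integral {0..L} (C m 2) = - \<Delta>t * ?b"
      using integral_increment[OF C012(3) C012(3) \<Delta>t scheme2[OF dg_space_const, of m 1]]
        a0[of 2 m] NH by simp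
    then have C2: "integral {0..L} (C (Suc m) 2) = integral {0..L} (C m 2) - \<Delta>t * ?b" by simp
    \<comment> \<open>The equation for \<open>C 0\<close> has no source, so its pairing with the
      mean potential is governed by transport alone.\<close>
    have "integral {0..L} (\<lambda>x. (C (Suc m) 0 x - C m 0 x) * ?\<Phi>h x) / \<Delta>t + ?a = 0"
      using scheme[OF _ _ \<Phi>h, of 0 m] NH by (simp add: b_form_def b_cell_def)
    then have "integral {0..L} (\<lambda>x. (C (Suc m) 0 x - C m 0 x) * ?\<Phi>h x) = - \<Delta>t * ?a"
      using \<Delta>t by (simp add: field_simps)
    note electric_energy_increment[OF P[of m] P[of "Suc m"] C012(1) C012(1), unfolded this]
    moreover have "vth ^ 3 / 2 * (sqrt 2 * ?b) + vth * ?a = 0"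
      using energy_exchange[OF Ph C NH vth] .
    \<comment> \<open>Both the kinetic and the electric increment carry the factor
      \<open>\<Delta>t\<close>; in this scaled form their sum cancels by plain algebra.\<close>
    then have "\<Delta>t * (vth ^ 3 / 2 * (sqrt 2 * ?b) + vth * ?a) = 0" by simp
    ultimately show ?thesis
      unfolding total_energy_eq[where D = "C (Suc m)", OF C012(1,3) E\<Phi>(1)]
        total_energy_eq[where D = "C m", OF C012(1,3) E\<Phi>(1)] C2 mass_Suc
      by (simp add: algebra_simps)
  qed
  have energy: "total_energy X N L vth \<beta> (C m) (E m) (\<Phi> m) = total_energy X N L vth \<beta> (C 0) (E 0) (\<Phi> 0)"
    for m
    by (induction m) (simp_all only: energy_Suc)
  have "integral {0..L} (C m l) = integral {0..L} (C 0 l)" if "l \<in> {0, 1}" for m l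
    using that moments[of m] by blast
  with energy show ?thesis by metis
qed

end
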